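(* Let $s$ be any valid Septoku board and let $c=s(19)$. Then there is a partition of $\{1,\dots,7\}\setminus\{c\}$ into three 2-element sets $P_1,P_2,P_3$ such that for every cell $x\in\{1,\dots,37\}$, with $y=38-x$ its image under the $180^\circ$ rotation of the board, either $\{s(x),s(y)\}=P_i$ for some $i\in\{1,2,3\}$ (so $s(x)\neq s(y)$), or $s(x)=s(y)=c$.
   Context: The Septoku board consists of 37 cells forming a regular hexagon of side 4 in a hexagonal grid, numbered row by row: $1$–$4$ (top row), $5$–$9$, $10$–$15$, $16$–$22$, $23$–$28$, $29$–$33$, $34$–$37$ (bottom row); the $180^\circ$ rotation of the board maps cell $i$ to cell $38-i$. The 21 "rows" of the board are: horizontal $\{1,2,3,4\}$, $\{5,\dots,9\}$, $\{10,\dots,15\}$, $\{16,\dots,22\}$, $\{23,\dots,28\}$, $\{29,\dots,33\}$, $\{34,\dots,37\}$; up-right $\{1,5,10,16\}$, $\{2,6,11,17,23\}$, $\{3,7,12,18,24,29\}$, $\{4,8,13,19,25,30,34\}$, $\{9,14,20,26,31,35\}$, $\{15,21,27,32,36\}$, $\{22,28,33,37\}$; down-right $\{4,9,15,22\}$, $\{3,8,14,21,28\}$, $\{2,7,13,20,27,33\}$, $\{1,6,12,19,26,32,37\}$, $\{5,11,18,25,31,36\}$, $\{10,17,24,30,35\}$, $\{16,23,29,34\}$. The seven "circles" are: $\{1,2,5,6,7,11,12\}$, $\{3,4,7,8,9,13,14\}$, $\{10,11,16,17,18,23,24\}$, $\{12,13,18,19,20,25,26\}$, $\{14,15,20,21,22,27,28\}$,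 $\{24,25,29,30,31,34,35\}$, $\{26,27,31,32,33,36,37\}$. A valid Septoku board is a map $s:\{1,\dots,37\}\to\{1,\dots,7\}$ such that the cells of each of the 21 rows receive pairwise distinct values and the seven cells of each circle receive pairwise distinct values. *)

theory Defs
  imports "HOL-Library.Disjoint_Sets" "HOL-Library.FuncSet"
begin

text \<open>
  The board is a hexagon of side 4 in a hexagonal grid, with its 37 cells numbered row by row:
  1--4 (top), 5--9, 10--15, 16--22, 23--28, 29--33, 34--37 (bottom). With this numbering the
  rotation by 180 degrees maps cell \<open>i\<close> to cell \<open>38 - i\<close>, and the centre is cell 19.
\<close>

definition cells :: "nat set" where
  "cells = {1..37}"

definition horizontal_rows :: "nat set set" where
  "horizontal_rows =
    {{1,2,3,4},
     {5,6,7,8,9},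
     {10,11,12,13,14,15},
     {16,17,18,19,20,21,22},
     {23,24,25,26,27,28},
     {29,30,31,32,33},
     {34,35,36,37}}"

definition up_right_rows :: "nat set set" where
  "up_right_rows =
    {{1,5,10,16},
     {2,6,11,17,23},
     {3,7,12,18,24,29},
     {4,8,13,19,25,30,34},
     {9,14,20,26,31,35},
     {15,21,27,32,36},
     {22,28,33,37}}"

definition down_right_rows :: "nat set set" where
  "down_right_rows =
    {{4,9,15,22},
     {3,8,14,21,28},
     {2,7,13,20,27,33},
     {1,6,12,19,26,32,37},
     {5,11,18,25,31,36},
     {10,17,24,30,35},
     {16,23,29,34}}"

definition rows :: "nat set set" where
  "rows = horizontal_rows \<union> up_right_rows \<union> down_right_rows"

definition circles :: "nat set set" where
  "circles =
    {{1,2,5,6,7,11,12},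
     {3,4,7,8,9,13,14},
     {10,11,16,17,18,23,24},
     {12,13,18,19,20,25,26},
     {14,15,20,21,22,27,28},
     {24,25,29,30,31,34,35},
     {26,27,31,32,33,36,37}}"

text \<open>Values of \<open>s\<close> outside \<open>cells\<close> are irrelevant.\<close>

definition valid_septoku :: "(nat \<Rightarrow> nat) \<Rightarrow> bool" where
  "valid_septoku s \<longleftrightarrow>
     s \<in> cells \<rightarrow> {1..7} \<and> (\<forall>R\<in>rows. inj_on s R) \<and> (\<forall>C\<in>circles. inj_on s C)"

end

theory Submission
  imports Defs "HOL-Library.Code_Binary_Nat"
begin

text \<open>
  The cells carrying a given value form a transversal: they meet every circle in exactly one cell
  and every row in at most one cell. The seven circles cover the board, so there are only 68
  transversals. The seven cells of the central circle carry all seven values; hence a valid board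
  chooses for each central cell \<open>k\<close> a transversal through \<open>k\<close>, and these seven transversals are
  pairwise disjoint. An exhaustive search shows that in each of the 24 families of this kind the
  rotation by 180 degrees maps the transversal through \<open>k\<close> into the one through \<open>38 - k\<close>.
\<close>

text \<open>Removing the cells that share a row with \<open>x\<close> prunes early: a circle left
  empty ends its branch. Cells of \<open>C\<close> other than \<open>x\<close> may come back through
  a later circle, so an output list may meet a circle twice. Such surplus lists are harmless,
  because only completeness of the enumeration is used.\<close>

fun transversals :: "'a list list \<Rightarrow> 'a list list \<Rightarrow> 'a list list" where
  "transversals Rs [] = [[]]"
| "transversals Rs (C # Cs) = concat (map (\<lambda>x.
     let N = concat (filter (\<lambda>R. x \<in> set R) Rs)
     in map ((#) x) (transversals Rs
          (map (filter (\<lambda>y. y \<notin> set N)) (filter (\<lambda>D. x \<notin> set D) Cs)))) C)"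

text \<open>The branch to follow picks the only cell \<open>x\<close> of \<open>F\<close> in the
  first circle. \<open>F\<close> has no other cell in the rows through \<open>x\<close>, so the
  trimmed circles still meet \<open>F\<close> in one cell each and the induction hypothesis applies
  to them.\<close>

lemma transversals_complete:
  assumes "\<And>R x y. R \<in> set Rs \<Longrightarrow> x \<in> F \<inter> set R \<Longrightarrow> y \<in> F \<inter> set R \<Longrightarrow> x = y"
    and "\<And>C. C \<in> set Cs \<Longrightarrow> \<exists>x. F \<inter> set C = {x}"
  shows "\<exists>p \<in> set (transversals Rs Cs). set p = F \<inter> \<Union> (set ` set Cs)"
  using assms(2)
proof (induction "length Cs" arbitrary: Cs rule: less_induct)
  case less
  show ?case
  proof (cases Cs)
    case Nil
    then show ?thesis by simp
  next
    case (Cons C Ds)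
    then obtain x where x: "F \<inter> set C = {x}"
      using less.prems by fastforce
    define N where "N = concat (filter (\<lambda>R. x \<in> set R) Rs)"
    define Es where "Es = map (filter (\<lambda>y. y \<notin> set N)) (filter (\<lambda>D. x \<notin> set D) Ds)"
    have N: "y = x" if y: "y \<in> F" "y \<in> set N" for y
    proof -
      obtain R where "R \<in> set Rs" "x \<in> set R" "y \<in> set R"
        using y(2) unfolding N_def by auto
      then show ?thesis
        using assms(1)[of R y x] x y(1) by blast
    qed
    \<comment> \<open>The side condition matters: \<open>x\<close> lies in \<open>N\<close> as soon
      as some row contains it, so trimming a circle through \<open>x\<close> would lose
      \<open>x\<close>.\<close>
    have trim: "F \<inter> set (filter (\<lambda>y. y \<notin> set N) D) = F \<inter> set D" if "x \<notin> set D" for D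
      using that N by auto
    have hit: "\<exists>z. F \<inter> set E = {z}" if E: "E \<in> set Es" for E
    proof -
      obtain D where "D \<in> set Ds" "x \<notin> set D" "E = filter (\<lambda>y. y \<notin> set N) D"
        using E unfolding Es_def by auto
      then show ?thesis
        using trim less.prems[of D] Cons by simp
    qed
    have "length Es < length Cs"
      unfolding Es_def Cons by (simp add: le_imp_less_Suc)
    from less.hyps[OF this hit]
    obtain p where p: "p \<in> set (transversals Rs Es)" "set p = F \<inter> \<Union> (set ` set Es)"
      by auto
    \<comment> \<open>A circle dropped for containing \<open>x\<close> meets \<open>F\<close> in
      \<open>x\<close> alone, so it adds nothing to the union once \<open>x\<close> is
      inserted.\<close>
    have "y = x" if D: "D \<in> set Ds" "x \<in> set D" "y \<in> F" "y \<in> set D" for D y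
    proof -
      obtain z where "F \<inter> set D = {z}"
        using less.prems[of D] D(1) Cons by auto
      moreover have "x \<in> F \<inter> set D" "y \<in> F \<inter> set D"
        using x D by blast+
      ultimately show ?thesis by simp
    qed
    then have "insert x (\<Union>D \<in> {D \<in> set Ds. x \<notin> set D}. F \<inter> set D)
        = insert x (\<Union>D \<in> set Ds. F \<inter> set D)"
      by blast
    moreover have "F \<inter> \<Union> (set ` set Es) = (\<Union>D \<in> {D \<in> set Ds. x \<notin> set D}. F \<inter> set D)"
      unfolding Es_def using trim by auto
    moreover have "F \<inter> \<Union> (set ` set Cs) = F \<inter> set C \<union> (\<Union>D \<in> set Ds. F \<inter> set D)"
      unfolding Cons by auto
    ultimately have "set (x # p) = F \<inter> \<Union> (set ` set Cs)"
      using x p(2) by simp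
    moreover have "x # p \<in> set (transversals Rs Cs)"
      using x p(1) unfolding Cons Es_def N_def by (auto simp: Let_def)
    ultimately show ?thesis by blast
  qed
qed

fun disjoint_choices :: "'a list \<Rightarrow> 'a list list \<Rightarrow> 'a list list list" where
  "disjoint_choices [] ps = [[]]"
| "disjoint_choices (k # ks) ps = concat (map (\<lambda>p.
     map ((#) p) (disjoint_choices ks (filter (list_all (\<lambda>x. x \<notin> set p)) ps)))
     (filter (\<lambda>p. k \<in> set p) ps))"

text \<open>After \<open>P k\<close> is chosen, every remaining \<open>P l\<close> survives the
  filter because it is disjoint from \<open>P k\<close>. The family keeps the order of
  \<open>ks\<close>, so positions in it can later be matched with cells.\<close>

lemma disjoint_choices_complete:
  assumes "distinct ks"
    and "\<And>k. k \<in> set ks \<Longrightarrow> P k \<in> set ps \<and> k \<in> set (P k)"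
    and "\<And>k l. k \<in> set ks \<Longrightarrow> l \<in> set ks \<Longrightarrow> k \<noteq> l \<Longrightarrow> set (P k) \<inter> set (P l) = {}"
  shows "map P ks \<in> set (disjoint_choices ks ps)"
  using assms
proof (induction ks arbitrary: ps)
  case Nil
  then show ?case by simp
next
  case (Cons k ks)
  have "map P ks \<in> set (disjoint_choices ks (filter (list_all (\<lambda>x. x \<notin> set (P k))) ps))"
  proof (rule Cons.IH)
    fix l assume l: "l \<in> set ks"
    then have "set (P k) \<inter> set (P l) = {}"
      using Cons.prems(1) by (intro Cons.prems(3)) auto
    then show "P l \<in> set (filter (list_all (\<lambda>x. x \<notin> set (P k))) ps) \<and> l \<in> set (P l)"
      using Cons.prems(2)[of l] l by (auto simp: list_all_iff)
  qed (use Cons.prems in auto)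
  then show ?case
    using Cons.prems(2)[of k] by auto
qed

text \<open>The search is carried out by evaluation, so the rows and circles are restated as
  lists.\<close>

definition row_lists :: "nat list list" where
  "row_lists =
    [[1,2,3,4], [5,6,7,8,9], [10,11,12,13,14,15], [16,17,18,19,20,21,22],
     [23,24,25,26,27,28], [29,30,31,32,33], [34,35,36,37],
     [1,5,10,16], [2,6,11,17,23], [3,7,12,18,24,29], [4,8,13,19,25,30,34],
     [9,14,20,26,31,35], [15,21,27,32,36], [22,28,33,37],
     [4,9,15,22], [3,8,14,21,28], [2,7,13,20,27,33], [1,6,12,19,26,32,37],
     [5,11,18,25,31,36], [10,17,24,30,35], [16,23,29,34]]"

definition circle_lists :: "nat list list" where
  "circle_lists =
    [[1,2,5,6,7,11,12], [3,4,7,8,9,13,14], [10,11,16,17,18,23,24], [12,13,18,19,20,25,26],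
     [14,15,20,21,22,27,28], [24,25,29,30,31,34,35], [26,27,31,32,33,36,37]]"

definition central_cells :: "nat list" where
  "central_cells = [12,13,18,19,20,25,26]"

lemma set_row_lists: "set ` set row_lists = rows"
  unfolding row_lists_def rows_def horizontal_rows_def up_right_rows_def down_right_rows_def
  by (simp only: list.set image_insert image_empty Un_insert_left Un_empty_left)

lemma set_circle_lists: "set ` set circle_lists = circles"
  unfolding circle_lists_def circles_def by simp

lemma Union_circles: "\<Union> circles = cells"
proof -
  have "set (concat circle_lists) = set [1..<38]"
    by code_simp
  then show ?thesis
    unfolding set_circle_lists [symmetric] cells_def by auto
qed

lemma card_circle: "C \<in> circles \<Longrightarrow> card C = 7"
  unfolding circles_def by auto

text \<open>The list of central cells is ordered so that the rotation reverses it.\<close>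

lemma disjoint_choices_symmetric:
  "list_all (\<lambda>ps. list_all2 (\<lambda>p q. list_all (\<lambda>x. 38 - x \<in> set q) p) ps (rev ps))
     (disjoint_choices central_cells (transversals row_lists circle_lists))"
  by code_simp

text \<open>An injection from seven cells into seven values is onto. Hence each value occurs exactly
  once in each circle.\<close>

lemma bij_betw_circle:
  assumes "valid_septoku s" and "C \<in> circles"
  shows "bij_betw s C {1..7}"
proof -
  have "inj_on s C"
    using assms unfolding valid_septoku_def by blast
  moreover have "s ` C \<subseteq> {1..7}"
    using assms Union_circles unfolding valid_septoku_def by blast
  ultimately show ?thesis
    using card_circle[OF assms(2)] by (simp add: bij_betw_def card_image card_subset_eq)
qed

lemma fibre_transversal:
  assumes "valid_septoku s" and "v \<in> {1..7}"
  shows "\<exists>p \<in> set (transversals row_lists circle_lists). set p = {x \<in> cells. s x = v}"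
proof -
  let ?F = "{x \<in> cells. s x = v}"
  have "\<exists>p \<in> set (transversals row_lists circle_lists).
      set p = ?F \<inter> \<Union> (set ` set circle_lists)"
  proof (rule transversals_complete)
    fix R x y
    assume R: "R \<in> set row_lists" and "x \<in> ?F \<inter> set R" "y \<in> ?F \<inter> set R"
    moreover have "inj_on s (set R)"
      using assms(1) set_row_lists R unfolding valid_septoku_def by blast
    ultimately show "x = y"
      by (auto dest: inj_onD)
  next
    fix C
    assume "C \<in> set circle_lists"
    then have C: "set C \<in> circles"
      using set_circle_lists by blast
    from bij_betw_circle[OF assms(1) this]
    have inj: "inj_on s (set C)" and img: "s ` set C = {1..7}"
      by (simp_all add: bij_betw_def)
    obtain x where x: "x \<in> set C" "s x = v"
      using img assms(2) by (metis imageE)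
    have "set C \<subseteq> cells"
      using C Union_circles by blast
    then have "?F \<inter> set C = {x}"
      using x inj by (auto dest: inj_onD)
    then show "\<exists>x. ?F \<inter> set C = {x}" ..
  qed
  \<comment> \<open>The circles cover the board, so the list found is the whole fibre.\<close>
  moreover have "?F \<inter> \<Union> (set ` set circle_lists) = ?F"
    unfolding set_circle_lists Union_circles by blast
  ultimately show ?thesis by simp
qed

lemma bij_betw_central_cells:
  assumes "valid_septoku s"
  shows "bij_betw s (set central_cells) {1..7}"
  by (rule bij_betw_circle[OF assms]) (simp add: central_cells_def circles_def)

text \<open>The search result is applied to the fibres of \<open>s\<close>, each indexed by the
  central cell that carries its value. The rotation then sends the fibre through \<open>k\<close>
  into the fibre through \<open>38 - k\<close>.\<close>

lemma value_opposite:
  assumes s: "valid_septoku s" and k: "k \<in> set central_cells"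
    and x: "x \<in> cells" "s x = s k"
  shows "s (38 - x) = s (38 - k)"
proof -
  have bij: "bij_betw s (set central_cells) {1..7}"
    by (rule bij_betw_central_cells[OF s])
  have "\<forall>v \<in> {1..7}. \<exists>p. p \<in> set (transversals row_lists circle_lists) \<and>
      set p = {x \<in> cells. s x = v}"
    using fibre_transversal[OF s] by blast
  from bchoice[OF this]
  obtain p where p: "\<forall>v \<in> {1..7}. p v \<in> set (transversals row_lists circle_lists) \<and>
      set (p v) = {x \<in> cells. s x = v}" ..
  define P where "P k = p (s k)" for k
  have in_range: "s l \<in> {1..7}" if "l \<in> set central_cells" for l
    using bij that by (auto simp: bij_betw_def)
  have P: "P l \<in> set (transversals row_lists circle_lists)"
    "set (P l) = {x \<in> cells. s x = s l}" if "l \<in> set central_cells" for l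
    using bspec[OF p in_range[OF that]] unfolding P_def by simp_all
  have central: "set central_cells \<subseteq> cells"
    unfolding central_cells_def cells_def by simp
  have "map P central_cells
      \<in> set (disjoint_choices central_cells (transversals row_lists circle_lists))"
  proof (rule disjoint_choices_complete)
    show "distinct central_cells"
      unfolding central_cells_def by simp
  next
    fix l
    assume "l \<in> set central_cells"
    then show "P l \<in> set (transversals row_lists circle_lists) \<and> l \<in> set (P l)"
      using P[of l] central by auto
  next
    fix l m
    assume lm: "l \<in> set central_cells" "m \<in> set central_cells" "l \<noteq> m"
    then have "s l \<noteq> s m"
      using bij by (auto simp: bij_betw_def inj_on_eq_iff)
    then show "set (P l) \<inter> set (P m) = {}"
      using P(2) lm by auto
  qed
  then have "list_all2 (\<lambda>p q. list_all (\<lambda>x. 38 - x \<in> set q) p)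
      (map P central_cells) (rev (map P central_cells))"
    using disjoint_choices_symmetric by (simp add: list_all_iff)
  \<comment> \<open>Reversing the family pairs the fibre of each central cell with that of the
    opposite one.\<close>
  moreover have "rev (map P central_cells) = map (\<lambda>l. P (38 - l)) central_cells"
    unfolding central_cells_def by simp
  ultimately have "\<forall>x \<in> set (P k). 38 - x \<in> set (P (38 - k))"
    using k by (simp add: list.rel_map list_all_iff list_all2_same)
  moreover have "38 - k \<in> set central_cells"
    using k unfolding central_cells_def by auto
  ultimately show ?thesis
    using x P(2)[OF k] P(2) by auto
qed

theorem theorem7:
  fixes s :: "nat \<Rightarrow> nat" and c :: nat
  assumes "valid_septoku s" and "c = s 19"
  shows "\<exists>P. partition_on ({1..7} - {c}) P \<and> card P = 3 \<and> (\<forall>p\<in>P. card p = 2) \<and>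
           (\<forall>x\<in>cells. ({s x, s (38 - x)} \<in> P \<and> s x \<noteq> s (38 - x)) \<or>
                        (s x = c \<and> s (38 - x) = c))"
proof -
  \<comment> \<open>The blocks are the value pairs of opposite cells on the central circle. Its
    seven cells carry all seven values, so the blocks are disjoint and omit only the value of the
    centre 19.\<close>
  let ?P = "{{s 12, s 26}, {s 13, s 25}, {s 18, s 20}}"
  have bij: "bij_betw s (set central_cells) {1..7}"
    by (rule bij_betw_central_cells[OF assms(1)])
  then have distinct: "distinct (map s central_cells)"
    unfolding distinct_map by (simp add: bij_betw_def central_cells_def)
  have all_values: "{1..7} = set (map s central_cells)"
    using bij by (simp add: bij_betw_def)
  have "partition_on ({1..7} - {c}) ?P"
    using distinct unfolding all_values assms(2) central_cells_def
    by (intro partition_onI) (auto simp: disjnt_def)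
  moreover have "card ?P = 3" and "\<forall>p\<in>?P. card p = 2"
    using distinct unfolding central_cells_def by (auto simp: doubleton_eq_iff)
  moreover have "({s x, s (38 - x)} \<in> ?P \<and> s x \<noteq> s (38 - x)) \<or> (s x = c \<and> s (38 - x) = c)"
    if "x \<in> cells" for x
  proof -
    have "s x \<in> {1..7}"
      using assms(1) that unfolding valid_septoku_def by blast
    \<comment> \<open>Every value already occurs at a central cell \<open>k\<close>. As
      \<open>s (38 - x)\<close> depends only on \<open>s x\<close>, the claim need only be checked
      for \<open>k\<close>; the centre \<open>k = 19\<close> is its own opposite and gives the
      second alternative.\<close>
    then obtain k where k: "k \<in> set central_cells" "s x = s k"
      unfolding all_values by auto
    have "s (38 - x) = s (38 - k)"
      by (rule value_opposite[OF assms(1) k(1) that k(2)])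
    moreover have "({s k, s (38 - k)} \<in> ?P \<and> s k \<noteq> s (38 - k)) \<or> (s k = c \<and> s (38 - k) = c)"
    proof -
      have "k = 12 \<or> k = 13 \<or> k = 18 \<or> k = 19 \<or> k = 20 \<or> k = 25 \<or> k = 26"
        using k(1) unfolding central_cells_def by simp
      then show ?thesis
        using distinct unfolding central_cells_def assms(2)
        by (elim disjE) (auto simp: doubleton_eq_iff)
    qed
    ultimately show ?thesis
      by (simp only: k(2))
  qed
  ultimately show ?thesis by blast
qed

end
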